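(* Let $k_{-1},k_0,k_1$ be nonnegative integers, $n=k_{-1}+k_0+k_1$, and let $t_1\le t$ be integers. Let $m_{\beta}$ ($\beta\in\{-1,0,1\}$) and $m_{\alpha,\beta}$ ($\alpha,\beta\in\{-1,0,1\}$) be nonnegative integers such that $$m_{-1}+m_0+m_1=n,$$ $$m_{\alpha,-1}+m_{\alpha,0}+m_{\alpha,1}=k_\alpha\quad\text{for all }\alpha\in\{-1,0,1\},$$ $$m_{-1,\beta}+m_{0,\beta}+m_{1,\beta}=m_\beta\quad\text{for all }\beta\in\{-1,0,1\},$$ $$\sum_{\beta=-1}^{1}\mathrm{mdp}(m_{-1,\beta},m_{0,\beta},m_{1,\beta})>t,$$ $$t_1+2\min(E_1,E_2,E_3)+2(m_{1,0}+m_{-1,0})\le t,$$ where $$E_1=2\min(m_{-1},m_1),$$ $$E_2=\min(m_{-1,1},m_{-1,-1})+\min(m_{1,1},m_{1,-1})+\min(m_{-1},m_1),$$ $$E_3=\min(m_{-1,1},m_{-1,-1})+\min(m_{1,1},m_{1,-1})+\min(m_{1,1}+m_{-1,-1},\,m_{-1,1}+m_{1,-1})+m_{0,1}+m_{0,-1}.$$ Then $$m(n,k_{-1},k_0,k_1,t)\ \ge\ h(n,m_{-1},m_0,m_1,t_1)\prod_{\beta=-1}^{1}\binom{m_\beta}{m_{-1,\beta}}\binom{m_{0,\beta}+m_{1,\beta}}{m_{0,\beta}}.$$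
   Context: For nonnegative integers $a_{-1},a_0,a_1$ with $a_{-1}+a_0+a_1=N$, $V_N(a_{-1},a_0,a_1)$ is the set of vectors in $\{-1,0,1\}^N$ having exactly $a_{-1}$ coordinates equal to $-1$, $a_0$ equal to $0$ and $a_1$ equal to $1$. $(\mathbf x,\mathbf y)$ denotes the standard dot product. For an integer $s$: $m(N,a_{-1},a_0,a_1,s)$ is the maximum of $|W|$ over $W\subset V_N(a_{-1},a_0,a_1)$ with $(\mathbf x,\mathbf y)\neq s$ for all distinct $\mathbf x,\mathbf y\in W$; $h(N,a_{-1},a_0,a_1,s)$ is the maximum of $|W|$ over $W\subset V_N(a_{-1},a_0,a_1)$ with $(\mathbf x,\mathbf y)<s$ for all distinct $\mathbf x,\mathbf y\in W$. $\mathrm{mdp}(a_{-1},a_0,a_1)$ is the minimum of $(\mathbf x,\mathbf y)$ over $\mathbf x,\mathbf y\in V_N(a_{-1},a_0,a_1)$ (not necessarily distinct); explicitly, it equals $-2\min(a_{-1},a_1)$ if $a_0\ge\max(a_{-1},a_1)-\min(a_{-1},a_1)$, and $\max(a_{-1},a_1)-3\min(a_{-1},a_1)-a_0$ otherwise. *)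

theory Defs
  imports Main "HOL-Library.FuncSet"
begin

text \<open>Vectors of length \<open>N\<close> are functions on \<open>{..<N}\<close>, extensional so that equality of
  functions is equality of vectors.  The set is empty unless \<open>a + b + c = N\<close>.\<close>

definition V :: "nat \<Rightarrow> nat \<Rightarrow> nat \<Rightarrow> nat \<Rightarrow> (nat \<Rightarrow> int) set" where
  "V N a b c = {x \<in> {..<N} \<rightarrow>\<^sub>E {-1, 0, 1}.
      card {i \<in> {..<N}. x i = -1} = a \<and>
      card {i \<in> {..<N}. x i = 0} = b \<and>
      card {i \<in> {..<N}. x i = 1} = c}"

definition dot :: "nat \<Rightarrow> (nat \<Rightarrow> int) \<Rightarrow> (nat \<Rightarrow> int) \<Rightarrow> int" where
  "dot N x y = (\<Sum>i<N. x i * y i)"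

definition m_max :: "nat \<Rightarrow> nat \<Rightarrow> nat \<Rightarrow> nat \<Rightarrow> int \<Rightarrow> nat" where
  "m_max N a b c s =
     Max (card ` {W. W \<subseteq> V N a b c \<and> (\<forall>x\<in>W. \<forall>y\<in>W. x \<noteq> y \<longrightarrow> dot N x y \<noteq> s)})"

definition h_max :: "nat \<Rightarrow> nat \<Rightarrow> nat \<Rightarrow> nat \<Rightarrow> int \<Rightarrow> nat" where
  "h_max N a b c s =
     Max (card ` {W. W \<subseteq> V N a b c \<and> (\<forall>x\<in>W. \<forall>y\<in>W. x \<noteq> y \<longrightarrow> dot N x y < s)})"

definition mdp :: "nat \<Rightarrow> nat \<Rightarrow> nat \<Rightarrow> int" where
  "mdp a b c = (let N = a + b + c in
     Min ((\<lambda>(x, y). dot N x y) ` (V N a b c \<times> V N a b c)))"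

text \<open>The sets under \<^const>\<open>Max\<close> and \<^const>\<open>Min\<close> are finite and nonempty (the empty family is
  always admissible), so the extrema are genuine.\<close>

lemma finite_V: "finite (V N a b c)"
  by (rule finite_subset[of _ "{..<N} \<rightarrow>\<^sub>E {-1, 0, 1}"]) (auto simp: V_def intro!: finite_PiE)

lemma V_nonempty: "V (a + b + c) a b c \<noteq> {}"
proof -
  let ?N = "a + b + c"
  define x :: "nat \<Rightarrow> int" where
    "x = restrict (\<lambda>i. if i < a then -1 else if i < a + b then 0 else 1) {..<?N}"
  have "{i \<in> {..<?N}. x i = -1} = {..<a}" "{i \<in> {..<?N}. x i = 0} = {a..<a+b}"
    "{i \<in> {..<?N}. x i = 1} = {a+b..<?N}"
    by (auto simp: x_def split: if_splits)
  moreover have "x \<in> {..<?N} \<rightarrow>\<^sub>E {-1, 0, 1}"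
    by (auto simp: x_def)
  ultimately have "x \<in> V ?N a b c"
    by (simp add: V_def)
  thus ?thesis by blast
qed

end

theory Submission
  imports Defs
begin

text \<open>Take an optimal family \<open>W\<close> for \<open>h\<close>, and replace each \<open>w \<in> W\<close> by all its refinements:
  the vectors \<open>x\<close> such that the pair \<open>(\<alpha>, \<beta>)\<close> occurs exactly \<open>mm \<alpha> \<beta>\<close> times among the
  \<open>(x i, w i)\<close>.  Two refinements of the same \<open>w\<close> have product at least the sum of the minimal
  products on the level sets of \<open>w\<close>, hence more than \<open>t\<close>.  Passing from distinct \<open>w, w'\<close> to
  refinements raises the product by at most
  \<open>2 * Min {E1, E2, E3} + 2 * (mm 1 0 + mm (-1) 0)\<close>, so it stays below \<open>t\<close>.  In particular the
  refinements of distinct vectors are distinct.\<close>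

section \<open>Ternary vectors on an arbitrary finite index set\<close>

text \<open>Generalizes \<open>V\<close> from \<open>{..<N}\<close> to any index set, since the
  level sets of a vector \<open>w\<close> need not be initial segments.\<close>

definition ternary :: "'a set \<Rightarrow> nat \<Rightarrow> nat \<Rightarrow> nat \<Rightarrow> ('a \<Rightarrow> int) set" where
  "ternary S a b c = {x \<in> S \<rightarrow>\<^sub>E {-1, 0, 1}.
      card {i \<in> S. x i = -1} = a \<and> card {i \<in> S. x i = 0} = b \<and> card {i \<in> S. x i = 1} = c}"

definition refinements :: "'a set \<Rightarrow> (int \<Rightarrow> int \<Rightarrow> nat) \<Rightarrow> ('a \<Rightarrow> int) \<Rightarrow> ('a \<Rightarrow> int) set" where
  "refinements S M w = {x \<in> S \<rightarrow>\<^sub>E {-1, 0, 1}.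
      \<forall>\<alpha>\<in>{-1, 0, 1}. \<forall>\<beta>\<in>{-1, 0, 1}. card {i \<in> S. x i = \<alpha> \<and> w i = \<beta>} = M \<alpha> \<beta>}"

lemma V_eq_ternary: "V N a b c = ternary {..<N} a b c"
  by (simp add: V_def ternary_def)

lemma card_ternary_domain:
  assumes "finite S" "x \<in> ternary S a b c"
  shows "card S = a + b + c"
proof -
  have "S = {i \<in> S. x i = -1} \<union> {i \<in> S. x i = 0} \<union> {i \<in> S. x i = 1}"
    using assms(2) by (auto simp: ternary_def PiE_iff)
  then have "card S = card ({i \<in> S. x i = -1} \<union> {i \<in> S. x i = 0} \<union> {i \<in> S. x i = 1})"
    by metis
  also have "\<dots> = card {i \<in> S. x i = -1} + card {i \<in> S. x i = 0} + card {i \<in> S. x i = 1}"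
    using assms(1) by (subst card_Un_disjoint, auto)+
  finally show ?thesis
    using assms(2) by (simp add: ternary_def)
qed

text \<open>Choose the set \<open>A\<close> of positions of -1, then the set \<open>Z\<close> of
  zeros in its complement; the positions of 1 are then forced.\<close>

lemma card_ternary:
  assumes S: "finite S" "card S = a + b + c"
  shows "card (ternary S a b c) = (card S choose a) * ((b + c) choose b)"
proof -
  define P where "P = (SIGMA A:{A. A \<subseteq> S \<and> card A = a}. {Z. Z \<subseteq> S - A \<and> card Z = b})"
  let ?g = "\<lambda>(A, Z). restrict (\<lambda>i. if i \<in> A then -1 else if i \<in> Z then 0 else (1::int)) S"
  let ?f = "\<lambda>x::'a \<Rightarrow> int. ({i \<in> S. x i = -1}, {i \<in> S. x i = 0})"
  have "bij_betw ?g P (ternary S a b c)"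
  proof (rule bij_betw_byWitness[where f' = ?f])
    show "\<forall>p\<in>P. ?f (?g p) = p"
      by (auto simp: P_def)
    show "\<forall>x\<in>ternary S a b c. ?g (?f x) = x"
      by (auto simp: ternary_def PiE_iff extensional_def fun_eq_iff)
    show "?g ` P \<subseteq> ternary S a b c"
    proof
      fix x assume "x \<in> ?g ` P"
      then obtain p where "p \<in> P" "x = ?g p"
        by (rule imageE)
      moreover obtain A Z where "p = (A, Z)"
        by (cases p)
      ultimately have "(A, Z) \<in> P" and x: "x = ?g (A, Z)"
        by simp_all
      then have A: "A \<subseteq> S" "card A = a" and Z: "Z \<subseteq> S - A" "card Z = b"
        by (auto simp: P_def)
      let ?x = "?g (A, Z)"
      have "{i \<in> S. ?x i = -1} = A" "{i \<in> S. ?x i = 0} = Z" "{i \<in> S. ?x i = 1} = (S - A) - Z"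
        using A Z by (auto split: if_splits)
      moreover have "card ((S - A) - Z) = c"
      proof -
        have "finite A" "finite Z"
          using A(1) Z(1) S(1) by (auto intro: finite_subset)
        with A Z S show ?thesis
          by (simp add: card_Diff_subset)
      qed
      ultimately show "x \<in> ternary S a b c"
        using A Z x by (simp add: ternary_def)
    qed
    show "?f ` ternary S a b c \<subseteq> P"
      by (auto simp: P_def ternary_def)
  qed
  then have "card (ternary S a b c) = card P"
    by (simp add: bij_betw_same_card)
  also have "\<dots> = (\<Sum>A | A \<subseteq> S \<and> card A = a. card {Z. Z \<subseteq> S - A \<and> card Z = b})"
    unfolding P_def using S(1) by (intro card_SigmaI) auto
  also have "\<dots> = (\<Sum>A | A \<subseteq> S \<and> card A = a. (b + c) choose b)"
  proof (rule sum.cong[OF refl])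
    fix A assume "A \<in> {A. A \<subseteq> S \<and> card A = a}"
    then have "card (S - A) = b + c"
      using S by (auto simp: card_Diff_subset finite_subset)
    then show "card {Z. Z \<subseteq> S - A \<and> card Z = b} = (b + c) choose b"
      using S(1) by (simp add: n_subsets)
  qed
  also have "\<dots> = (card S choose a) * ((b + c) choose b)"
    using S(1) by (simp add: n_subsets)
  finally show ?thesis .
qed

text \<open>A bijection \<open>h\<close> from \<open>{..<?N}\<close> to \<open>S\<close> carries
  both vectors into \<open>V\<close>, preserving value counts and product, so the minimum defining
  \<open>mdp\<close> applies.\<close>

lemma mdp_le_sum:
  assumes "finite S" "x \<in> ternary S a b c" "y \<in> ternary S a b c"
  shows "mdp a b c \<le> (\<Sum>i\<in>S. x i * y i)"
proof -
  let ?N = "a + b + c"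
  have "card S = ?N"
    using card_ternary_domain assms(1,2) by blast
  then obtain h where h: "bij_betw h {..<?N} S"
    using ex_bij_betw_nat_finite[OF assms(1)] by (auto simp: atLeast0LessThan)
  have V: "restrict (z \<circ> h) {..<?N} \<in> V ?N a b c" if z: "z \<in> ternary S a b c" for z
  proof -
    have "card {i \<in> {..<?N}. restrict (z \<circ> h) {..<?N} i = \<alpha>} = card {j \<in> S. z j = \<alpha>}" for \<alpha>
    proof (rule bij_betw_same_card[of h])
      have "h ` {i \<in> {..<?N}. restrict (z \<circ> h) {..<?N} i = \<alpha>} = {j \<in> S. z j = \<alpha>}"
        using bij_betw_imp_surj_on[OF h] by auto
      with h show "bij_betw h {i \<in> {..<?N}. restrict (z \<circ> h) {..<?N} i = \<alpha>} {j \<in> S. z j = \<alpha>}"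
        by (auto simp: bij_betw_def inj_on_def)
    qed
    moreover have "restrict (z \<circ> h) {..<?N} \<in> {..<?N} \<rightarrow>\<^sub>E {-1, 0, 1}"
      using z bij_betwE[OF h] by (auto simp: ternary_def PiE_iff)
    ultimately show ?thesis
      using z by (simp add: V_def ternary_def)
  qed
  have "dot ?N (restrict (x \<circ> h) {..<?N}) (restrict (y \<circ> h) {..<?N}) = (\<Sum>i<?N. x (h i) * y (h i))"
    by (simp add: dot_def)
  also have "\<dots> = (\<Sum>i\<in>S. x i * y i)"
    using sum.reindex_bij_betw[OF h, of "\<lambda>i. x i * y i"] by simp
  finally show ?thesis
    unfolding mdp_def Let_def using V[OF assms(2)] V[OF assms(3)]
    by (intro Min_le) (force intro: finite_V)+
qed

section \<open>Counting refinements and multiplying those of one vector\<close>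

lemma restrict_refinement_in_ternary:
  assumes "x \<in> refinements S M w" "\<beta> \<in> {-1, 0, 1}"
  shows "restrict x {i \<in> S. w i = \<beta>} \<in> ternary {i \<in> S. w i = \<beta>} (M (-1) \<beta>) (M 0 \<beta>) (M 1 \<beta>)"
proof -
  have "card {i \<in> {i \<in> S. w i = \<beta>}. restrict x {i \<in> S. w i = \<beta>} i = \<alpha>} = M \<alpha> \<beta>"
    if "\<alpha> \<in> {-1, 0, 1}" for \<alpha>
  proof -
    have "{i \<in> {i \<in> S. w i = \<beta>}. restrict x {i \<in> S. w i = \<beta>} i = \<alpha>} = {i \<in> S. x i = \<alpha> \<and> w i = \<beta>}"
      by auto
    with that assms show ?thesis
      by (auto simp: refinements_def)
  qed
  then show ?thesis
    using assms(1) by (auto simp: ternary_def refinements_def PiE_iff)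
qed

text \<open>A refinement amounts to independent choices of one ternary vector on each level set of
  \<open>w\<close>, so the count is a product.\<close>

lemma card_refinements:
  assumes S: "finite S" and w: "w \<in> S \<rightarrow> {-1, 0, 1}"
    and M: "\<And>\<beta>. \<beta> \<in> {-1, 0, 1} \<Longrightarrow> card {i \<in> S. w i = \<beta>} = M (-1) \<beta> + M 0 \<beta> + M 1 \<beta>"
  shows "card (refinements S M w) =
    (\<Prod>\<beta>\<in>{-1, 0, 1}. (card {i \<in> S. w i = \<beta>} choose M (-1) \<beta>) * ((M 0 \<beta> + M 1 \<beta>) choose M 0 \<beta>))"
proof -
  let ?B = "{-1, 0, 1 :: int}" and ?S = "\<lambda>\<beta>. {i \<in> S. w i = \<beta>}"
  let ?T = "\<lambda>\<beta>. ternary (?S \<beta>) (M (-1) \<beta>) (M 0 \<beta>) (M 1 \<beta>)"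
  \<comment> \<open>\<open>?g\<close> glues a family of vectors on the level sets, reading
    coordinate \<open>i\<close> from the member indexed by \<open>w i\<close>; \<open>?f\<close>
    cuts a vector back into its restrictions.\<close>
  let ?g = "\<lambda>f. restrict (\<lambda>i. f (w i) i) S"
  let ?f = "\<lambda>x. restrict (\<lambda>\<beta>. restrict x (?S \<beta>)) ?B"
  have "bij_betw ?g (PiE ?B ?T) (refinements S M w)"
  proof (rule bij_betw_byWitness[where f' = ?f])
    show "\<forall>f\<in>PiE ?B ?T. ?f (?g f) = f"
    proof
      fix f assume f: "f \<in> PiE ?B ?T"
      show "?f (?g f) = f"
      proof
        fix \<beta>
        show "?f (?g f) \<beta> = f \<beta>"
        proof (cases "\<beta> \<in> ?B")
          case True
          then have "f \<beta> \<in> extensional (?S \<beta>)"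
            using f by (auto simp: PiE_iff ternary_def)
          with True show ?thesis
            by (auto simp: extensional_def fun_eq_iff)
        next
          case False
          then show ?thesis
            using f by (auto simp: PiE_iff extensional_def)
        qed
      qed
    qed
    show "\<forall>x\<in>refinements S M w. ?g (?f x) = x"
      using w by (fastforce simp: refinements_def PiE_iff extensional_def fun_eq_iff)
    show "?g ` PiE ?B ?T \<subseteq> refinements S M w"
    proof clarify
      fix f assume f: "f \<in> PiE ?B ?T"
      have "card {i \<in> S. ?g f i = \<alpha> \<and> w i = \<beta>} = M \<alpha> \<beta>" if "\<alpha> \<in> ?B" "\<beta> \<in> ?B" for \<alpha> \<beta>
      proof -
        have "{i \<in> S. ?g f i = \<alpha> \<and> w i = \<beta>} = {i \<in> ?S \<beta>. f \<beta> i = \<alpha>}"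
          by auto
        moreover have "f \<beta> \<in> ?T \<beta>"
          using f that(2) by blast
        ultimately show ?thesis
          using that(1) by (auto simp: ternary_def)
      qed
      moreover have "?g f i \<in> ?B" if "i \<in> S" for i
      proof -
        have "f (w i) \<in> ?T (w i)"
          using f w that by blast
        with that show ?thesis
          by (auto simp: ternary_def PiE_iff)
      qed
      ultimately show "?g f \<in> refinements S M w"
        by (simp add: refinements_def PiE_iff)
    qed
    show "?f ` refinements S M w \<subseteq> PiE ?B ?T"
      using restrict_refinement_in_ternary by fastforce
  qed
  then have "card (refinements S M w) = card (PiE ?B ?T)"
    by (simp add: bij_betw_same_card)
  also have "\<dots> = (\<Prod>\<beta>\<in>?B. card (?T \<beta>))"
    by (rule card_PiE) simp
  also have "\<dots> = (\<Prod>\<beta>\<in>?B. (card (?S \<beta>) choose M (-1) \<beta>) * ((M 0 \<beta> + M 1 \<beta>) choose M 0 \<beta>))"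
    using S M by (intro prod.cong refl card_ternary) auto
  finally show ?thesis .
qed

text \<open>Split the product along the level sets of \<open>w\<close>: on each of them
  \<open>x\<close> and \<open>y\<close> have the same value counts, so \<open>mdp_le_sum\<close>
  bounds that part.\<close>

lemma sum_mdp_le_sum_refinements:
  assumes S: "finite S" and w: "w \<in> S \<rightarrow> {-1, 0, 1}"
    and x: "x \<in> refinements S M w" and y: "y \<in> refinements S M w"
  shows "(\<Sum>\<beta>\<in>{-1, 0, 1}. mdp (M (-1) \<beta>) (M 0 \<beta>) (M 1 \<beta>)) \<le> (\<Sum>i\<in>S. x i * y i)"
proof -
  have "(\<Sum>\<beta>\<in>{-1, 0, 1}. mdp (M (-1) \<beta>) (M 0 \<beta>) (M 1 \<beta>))
      \<le> (\<Sum>\<beta>\<in>{-1, 0, 1}. \<Sum>i | i \<in> S \<and> w i = \<beta>. x i * y i)"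
  proof (rule sum_mono)
    fix \<beta> :: int assume \<beta>: "\<beta> \<in> {-1, 0, 1}"
    show "mdp (M (-1) \<beta>) (M 0 \<beta>) (M 1 \<beta>) \<le> (\<Sum>i | i \<in> S \<and> w i = \<beta>. x i * y i)"
      using mdp_le_sum[OF _ restrict_refinement_in_ternary[OF x \<beta>]
          restrict_refinement_in_ternary[OF y \<beta>]] S
      by simp
  qed
  also have "\<dots> = (\<Sum>i\<in>S. x i * y i)"
    using S w by (intro sum.group) auto
  finally show ?thesis .
qed

lemma refinements_subset_ternary:
  assumes S: "finite S" and w: "w \<in> S \<rightarrow> {-1, 0, 1}"
    and k: "\<And>\<alpha>. \<alpha> \<in> {-1, 0, 1} \<Longrightarrow> M \<alpha> (-1) + M \<alpha> 0 + M \<alpha> 1 = k \<alpha>"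
  shows "refinements S M w \<subseteq> ternary S (k (-1)) (k 0) (k 1)"
proof
  fix x assume x: "x \<in> refinements S M w"
  have "card {i \<in> S. x i = \<alpha>} = k \<alpha>" if \<alpha>: "\<alpha> \<in> {-1, 0, 1}" for \<alpha>
  proof -
    let ?A = "\<lambda>\<beta>. {i \<in> S. x i = \<alpha> \<and> w i = \<beta>}"
    have "{i \<in> S. x i = \<alpha>} = ?A (-1) \<union> ?A 0 \<union> ?A 1"
      using w by auto
    moreover have "card (?A (-1) \<union> ?A 0 \<union> ?A 1) = card (?A (-1)) + card (?A 0) + card (?A 1)"
      using S by (subst card_Un_disjoint, auto)+
    ultimately show ?thesis
      using x \<alpha> k[OF \<alpha>] by (auto simp: refinements_def)
  qed
  with x show "x \<in> ternary S (k (-1)) (k 0) (k 1)"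
    by (auto simp: ternary_def refinements_def)
qed

section \<open>Increase of the product under refinement\<close>

text \<open>Meant for a pattern \<open>P\<close> involving both vectors and both refinements, where
  \<open>Q\<close> concerns one vector with its refinement and \<open>R\<close> the other, so that
  both cardinalities are known.\<close>

lemma sum_of_bool_le_min:
  assumes "finite S" "\<And>i. i \<in> S \<Longrightarrow> P i \<Longrightarrow> Q i" "\<And>i. i \<in> S \<Longrightarrow> P i \<Longrightarrow> R i"
  shows "(\<Sum>i\<in>S. of_bool (P i) :: int) \<le> int (min (card {i \<in> S. Q i}) (card {i \<in> S. R i}))"
proof -
  have "card {i \<in> S. P i} \<le> card {i \<in> S. Q i}" "card {i \<in> S. P i} \<le> card {i \<in> S. R i}"
    using assms by (auto intro!: card_mono)
  then show ?thesis
    using assms(1) by (simp add: sum_of_bool_eq Int_def)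
qed

lemma card_Collect_disjoint:
  assumes "finite S" "\<And>i. i \<in> S \<Longrightarrow> \<not> (P i \<and> Q i)"
  shows "card {i \<in> S. P i \<or> Q i} = card {i \<in> S. P i} + card {i \<in> S. Q i}"
proof -
  have "{i \<in> S. P i \<or> Q i} = {i \<in> S. P i} \<union> {i \<in> S. Q i}"
    by auto
  with assms show ?thesis
    by (auto intro: card_Un_disjoint)
qed

text \<open>Three coordinatewise bounds of \<open>x i * y i - w i * v i\<close> by indicators of
  patterns are summed, one for each entry of the minimum. The factors 2 arise because patterns come
  in pairs, exchanging the two vectors or their signs.\<close>

lemma refinements_product_increase:
  fixes M :: "int \<Rightarrow> int \<Rightarrow> nat" and m :: "int \<Rightarrow> nat"
  assumes S: "finite S"
    and w: "w \<in> S \<rightarrow> {-1, 0, 1}" "\<And>\<beta>. \<beta> \<in> {-1, 0, 1} \<Longrightarrow> card {i \<in> S. w i = \<beta>} = m \<beta>"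
    and v: "v \<in> S \<rightarrow> {-1, 0, 1}" "\<And>\<beta>. \<beta> \<in> {-1, 0, 1} \<Longrightarrow> card {i \<in> S. v i = \<beta>} = m \<beta>"
    and x: "x \<in> refinements S M w" and y: "y \<in> refinements S M v"
  defines "K \<equiv> min (M (-1) 1) (M (-1) (-1)) + min (M 1 1) (M 1 (-1))"
  shows "(\<Sum>i\<in>S. x i * y i) - (\<Sum>i\<in>S. w i * v i) \<le>
    2 * int (Min {2 * min (m (-1)) (m 1), K + min (m (-1)) (m 1),
      K + min (M 1 1 + M (-1) (-1)) (M (-1) 1 + M 1 (-1)) + M 0 1 + M 0 (-1)})
    + 2 * int (M 1 0 + M (-1) 0)"
    (is "?D \<le> 2 * int (Min {?E1, ?E2, ?E3}) + 2 * int ?Z")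
proof -
  define N :: "(int \<Rightarrow> int \<Rightarrow> int \<Rightarrow> int \<Rightarrow> bool) \<Rightarrow> int"
    where "N P = (\<Sum>i\<in>S. of_bool (P (x i) (w i) (y i) (v i)))" for P
  have vals: "x i \<in> {-1, 0, 1}" "w i \<in> {-1, 0, 1}" "y i \<in> {-1, 0, 1}" "v i \<in> {-1, 0, 1}"
    if "i \<in> S" for i
    using that w(1) v(1) x y by (auto simp: refinements_def)
  have cx: "card {i \<in> S. x i = \<alpha> \<and> w i = \<beta>} = M \<alpha> \<beta>"
    and cy: "card {i \<in> S. y i = \<alpha> \<and> v i = \<beta>} = M \<alpha> \<beta>"
    if "\<alpha> \<in> {-1, 0, 1}" "\<beta> \<in> {-1, 0, 1}" for \<alpha> \<beta>
    using that x y by (auto simp: refinements_def)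
  have N_le: "N P \<le> int (min (card {i \<in> S. Q (x i) (w i)}) (card {i \<in> S. R (y i) (v i)}))"
    if "\<And>a b c d. P a b c d \<Longrightarrow> Q a b \<and> R c d" for P Q R
    unfolding N_def using that S by (intro sum_of_bool_le_min) blast+
  \<comment> \<open>Patterns in \<open>(a, b, c, d) = (x i, w i, y i, v i)\<close>.
    \<open>?Zx\<close>, \<open>?Zy\<close>: a zero becomes nonzero. \<open>?Ox\<close>,
    \<open>?Oy\<close>: a nonzero entry becomes zero. \<open>?P\<close>, \<open>?Q\<close>:
    \<open>w\<close> and \<open>v\<close> have opposite signs. \<open>?A\<close>: moreover both
    refinements take the value \<alpha>. \<open>?pos\<close>, \<open>?neg\<close>: the sign is kept
    or flipped.\<close>
  let ?Zx = "\<lambda>a b c d::int. (a = 1 \<and> b = (0::int)) \<or> (a = (-1::int) \<and> b = 0)"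
  let ?Zy = "\<lambda>a b c d::int. (c = 1 \<and> d = (0::int)) \<or> (c = (-1::int) \<and> d = 0)"
  let ?Ox = "\<lambda>a b c d::int. (a = 0 \<and> b = (1::int)) \<or> (a = (0::int) \<and> b = -1)"
  let ?Oy = "\<lambda>a b c d::int. (c = 0 \<and> d = (1::int)) \<or> (c = (0::int) \<and> d = -1)"
  let ?P = "\<lambda>a b c d::int. b = (-1::int) \<and> d = 1"
  let ?Q = "\<lambda>a b c d::int. b = (1::int) \<and> d = -1"
  let ?A = "\<lambda>\<alpha> \<beta> a b c d::int. (a = \<alpha> \<and> b = (\<beta>::int)) \<and> (c = \<alpha> \<and> d = -\<beta>)"
  let ?pos = "\<lambda>a b::int. (a = 1 \<and> b = 1) \<or> (a = -1 \<and> b = -1)"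
  let ?neg = "\<lambda>a b::int. (a = -1 \<and> b = 1) \<or> (a = 1 \<and> b = -1)"

  \<comment> \<open>Without \<open>of_bool_or_iff\<close> each disjunction stays under a single
    \<open>of_bool\<close>, so the sum becomes a cardinality.\<close>
  have Zx: "N ?Zx \<le> int ?Z" and Ox: "N ?Ox \<le> int (M 0 1 + M 0 (-1))"
    unfolding N_def using S
    by (simp_all del: of_bool_or_iff add: sum_of_bool_eq Int_def card_Collect_disjoint cx)
  have Zy: "N ?Zy \<le> int ?Z" and Oy: "N ?Oy \<le> int (M 0 1 + M 0 (-1))"
    unfolding N_def using S
    by (simp_all del: of_bool_or_iff add: sum_of_bool_eq Int_def card_Collect_disjoint cy)
  have P: "N ?P \<le> int (min (m (-1)) (m 1))"
    using N_le[of ?P "\<lambda>a b. b = -1" "\<lambda>c d. d = 1"] w(2) v(2) by simp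
  have Q: "N ?Q \<le> int (min (m (-1)) (m 1))"
    using N_le[of ?Q "\<lambda>a b. b = 1" "\<lambda>c d. d = -1"] w(2) v(2) by (simp add: min.commute)
  have A: "N (?A \<alpha> \<beta>) \<le> int (min (M \<alpha> 1) (M \<alpha> (-1)))"
    if "\<alpha> \<in> {-1, 1}" "\<beta> \<in> {-1, 1}" for \<alpha> \<beta>
    using N_le[of "?A \<alpha> \<beta>" "\<lambda>a b. a = \<alpha> \<and> b = \<beta>" "\<lambda>c d. c = \<alpha> \<and> d = -\<beta>"] that cx cy
    by (auto simp: min.commute)
  \<comment> \<open>For each \<alpha> both signs of \<beta> have the same bound, hence twice
    \<open>K\<close>.\<close>
  have A4: "N (?A (-1) 1) + N (?A (-1) (-1)) + N (?A 1 1) + N (?A 1 (-1)) \<le> 2 * int K"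
    using A[of "-1" 1] A[of "-1" "-1"] A[of 1 1] A[of 1 "-1"] by (simp add: K_def)
  have pos_neg: "N (\<lambda>a b c d. ?pos a b \<and> ?neg c d)
      \<le> int (min (M 1 1 + M (-1) (-1)) (M (-1) 1 + M 1 (-1)))"
    using N_le[of "\<lambda>a b c d. ?pos a b \<and> ?neg c d" ?pos ?neg] S by (simp add: card_Collect_disjoint cx cy)
  have neg_pos: "N (\<lambda>a b c d. ?neg a b \<and> ?pos c d)
      \<le> int (min (M 1 1 + M (-1) (-1)) (M (-1) 1 + M 1 (-1)))"
    using N_le[of "\<lambda>a b c d. ?neg a b \<and> ?pos c d" ?neg ?pos] S
    by (simp add: card_Collect_disjoint cx cy min.commute)

  have D: "?D = (\<Sum>i\<in>S. x i * y i - w i * v i)"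
    by (simp add: sum_subtractf)

  \<comment> \<open>Where \<open>w i * v i = -1\<close> the increase is at most 2. Elsewhere it is
    positive only if \<open>x i * y i = 1\<close> and \<open>w i * v i = 0\<close>, so some zero has
    become nonzero.\<close>
  have "?D \<le> 2 * N ?P + 2 * N ?Q + N ?Zx + N ?Zy"
    unfolding D N_def sum_distrib_left sum.distrib[symmetric]
  proof (rule sum_mono)
    fix i assume "i \<in> S"
    with vals[OF this] show "x i * y i - w i * v i \<le>
      2 * of_bool (?P (x i) (w i) (y i) (v i)) + 2 * of_bool (?Q (x i) (w i) (y i) (v i))
      + of_bool (?Zx (x i) (w i) (y i) (v i)) + of_bool (?Zy (x i) (w i) (y i) (v i))"
      by (elim insertE emptyE) simp_all
  qed
  then have 1: "?D \<le> 2 * int ?E1 + 2 * int ?Z"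
    using P Q Zx Zy by simp

  txt \<open>Where \<open>w i * v i = -1\<close> the increase is \<open>1 + x i * y i\<close>.  The two summands are bounded
    separately: the first by \<open>?P\<close> and \<open>?Q\<close>, the second by \<open>?A\<close>.\<close>
  have "?D \<le> N ?P + N ?Q + (N (?A (-1) 1) + N (?A (-1) (-1)) + N (?A 1 1) + N (?A 1 (-1)))
      + N ?Zx + N ?Zy"
    unfolding D N_def sum_distrib_left sum.distrib[symmetric]
  proof (rule sum_mono)
    fix i assume "i \<in> S"
    with vals[OF this] show "x i * y i - w i * v i \<le>
      of_bool (?P (x i) (w i) (y i) (v i)) + of_bool (?Q (x i) (w i) (y i) (v i))
      + (of_bool (?A (-1) 1 (x i) (w i) (y i) (v i)) + of_bool (?A (-1) (-1) (x i) (w i) (y i) (v i))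
        + of_bool (?A 1 1 (x i) (w i) (y i) (v i)) + of_bool (?A 1 (-1) (x i) (w i) (y i) (v i)))
      + of_bool (?Zx (x i) (w i) (y i) (v i)) + of_bool (?Zy (x i) (w i) (y i) (v i))"
      by (elim insertE emptyE) simp_all
  qed
  then have 2: "?D \<le> 2 * int ?E2 + 2 * int ?Z"
    using P Q A4 Zx Zy by simp

  txt \<open>If moreover \<open>x i * y i = 1\<close>, then \<open>x i * w i\<close> and \<open>y i * v i\<close> have opposite signs, so the
    first summand can also be counted by these signs.\<close>
  have "?D \<le> N (\<lambda>a b c d. ?pos a b \<and> ?neg c d) + N (\<lambda>a b c d. ?neg a b \<and> ?pos c d)
      + (N (?A (-1) 1) + N (?A (-1) (-1)) + N (?A 1 1) + N (?A 1 (-1)))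
      + N ?Ox + N ?Oy + N ?Zx + N ?Zy"
    unfolding D N_def sum_distrib_left sum.distrib[symmetric]
  proof (rule sum_mono)
    fix i assume "i \<in> S"
    with vals[OF this] show "x i * y i - w i * v i \<le>
      of_bool (?pos (x i) (w i) \<and> ?neg (y i) (v i)) + of_bool (?neg (x i) (w i) \<and> ?pos (y i) (v i))
      + (of_bool (?A (-1) 1 (x i) (w i) (y i) (v i)) + of_bool (?A (-1) (-1) (x i) (w i) (y i) (v i))
        + of_bool (?A 1 1 (x i) (w i) (y i) (v i)) + of_bool (?A 1 (-1) (x i) (w i) (y i) (v i)))
      + of_bool (?Ox (x i) (w i) (y i) (v i)) + of_bool (?Oy (x i) (w i) (y i) (v i))
      + of_bool (?Zx (x i) (w i) (y i) (v i)) + of_bool (?Zy (x i) (w i) (y i) (v i))"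
      by (elim insertE emptyE) simp_all
  qed
  \<comment> \<open>Where \<open>w i * v i = -1\<close> and \<open>x i * y i = 0\<close>, the
    increase of 1 is caught by \<open>?Ox\<close> or \<open>?Oy\<close>; this accounts for the last
    two summands of \<open>?E3\<close>.\<close>
  then have 3: "?D \<le> 2 * int ?E3 + 2 * int ?Z"
    using pos_neg neg_pos A4 Ox Oy Zx Zy by simp

  have "Min {?E1, ?E2, ?E3} \<in> {?E1, ?E2, ?E3}"
    by (rule Min_in) auto
  with 1 2 3 show ?thesis
    by (elim insertE) (simp_all only: empty_iff)
qed

section \<open>Refining an optimal family\<close>

theorem mainTheorem2:
  fixes n :: nat and k m :: "int \<Rightarrow> nat" and mm :: "int \<Rightarrow> int \<Rightarrow> nat"
    and t t1 :: int and E1 E2 E3 :: nat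
  assumes n: "n = k (-1) + k 0 + k 1"
    and t1_le: "t1 \<le> t"
    and m_sum: "m (-1) + m 0 + m 1 = n"
    and row: "\<forall>\<alpha>\<in>{-1, 0, 1}. mm \<alpha> (-1) + mm \<alpha> 0 + mm \<alpha> 1 = k \<alpha>"
    and col: "\<forall>\<beta>\<in>{-1, 0, 1}. mm (-1) \<beta> + mm 0 \<beta> + mm 1 \<beta> = m \<beta>"
    and mdp_gt: "(\<Sum>\<beta>\<in>{-1, 0, 1}. mdp (mm (-1) \<beta>) (mm 0 \<beta>) (mm 1 \<beta>)) > t"
    and E1: "E1 = 2 * min (m (-1)) (m 1)"
    and E2: "E2 = min (mm (-1) 1) (mm (-1) (-1)) + min (mm 1 1) (mm 1 (-1))
               + min (m (-1)) (m 1)"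
    and E3: "E3 = min (mm (-1) 1) (mm (-1) (-1)) + min (mm 1 1) (mm 1 (-1))
               + min (mm 1 1 + mm (-1) (-1)) (mm (-1) 1 + mm 1 (-1))
               + mm 0 1 + mm 0 (-1)"
    and t1_bound: "t1 + 2 * int (Min {E1, E2, E3}) + 2 * int (mm 1 0 + mm (-1) 0) \<le> t"
  shows "m_max n (k (-1)) (k 0) (k 1) t \<ge>
           h_max n (m (-1)) (m 0) (m 1) t1 *
           (\<Prod>\<beta>\<in>{-1, 0, 1}. (m \<beta> choose mm (-1) \<beta>) * ((mm 0 \<beta> + mm 1 \<beta>) choose mm 0 \<beta>))"
proof -
  let ?R = "refinements {..<n} mm"
  let ?H = "{W. W \<subseteq> V n (m (-1)) (m 0) (m 1) \<and> (\<forall>x\<in>W. \<forall>y\<in>W. x \<noteq> y \<longrightarrow> dot n x y < t1)}"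
  let ?M = "{W. W \<subseteq> V n (k (-1)) (k 0) (k 1) \<and> (\<forall>x\<in>W. \<forall>y\<in>W. x \<noteq> y \<longrightarrow> dot n x y \<noteq> t)}"
  let ?p = "\<Prod>\<beta>\<in>{-1, 0, 1}. (m \<beta> choose mm (-1) \<beta>) * ((mm 0 \<beta> + mm 1 \<beta>) choose mm 0 \<beta>)"
  have fin_H: "finite ?H" and fin_M: "finite ?M"
    by (auto intro: finite_subset[of _ "Pow _"] simp: finite_V)
  have "h_max n (m (-1)) (m 0) (m 1) t1 \<in> card ` ?H"
    unfolding h_max_def using fin_H by (intro Max_in) auto
  then obtain W where W: "W \<subseteq> V n (m (-1)) (m 0) (m 1)"
      "\<And>w v. w \<in> W \<Longrightarrow> v \<in> W \<Longrightarrow> w \<noteq> v \<Longrightarrow> dot n w v < t1"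
    and h: "h_max n (m (-1)) (m 0) (m 1) t1 = card W"
    by auto
  have vals: "w \<in> {..<n} \<rightarrow> {-1, 0, 1}" if "w \<in> W" for w
    using W(1) that by (auto simp: V_def PiE_iff)
  have count: "card {i \<in> {..<n}. w i = \<beta>} = m \<beta>" if "w \<in> W" "\<beta> \<in> {-1, 0, 1}" for w \<beta>
    using W(1) that by (auto simp: V_def)
  \<comment> \<open>The case \<open>x = y\<close> is included; disjointness below relies on
    it.\<close>
  have same: "dot n x y > t" if "w \<in> W" "x \<in> ?R w" "y \<in> ?R w" for w x y
    using sum_mdp_le_sum_refinements[OF _ vals[OF that(1)] that(2,3)] mdp_gt by (simp add: dot_def)
  have diff: "dot n x y < t" if "w \<in> W" "v \<in> W" "w \<noteq> v" "x \<in> ?R w" "y \<in> ?R v" for w v x y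
  proof -
    have "dot n x y - dot n w v \<le> 2 * int (Min {E1, E2, E3}) + 2 * int (mm 1 0 + mm (-1) 0)"
      unfolding dot_def E1 E2 E3
      by (rule refinements_product_increase) (use that vals count in auto)
    \<comment> \<open>The strict inequality \<open>dot n w v < t1\<close> makes the conclusion
      strict.\<close>
    with W(2)[OF that(1-3)] t1_bound show ?thesis
      by linarith
  qed
  have "(\<Union>w\<in>W. ?R w) \<in> ?M"
  proof (intro CollectI conjI ballI impI)
    show "(\<Union>w\<in>W. ?R w) \<subseteq> V n (k (-1)) (k 0) (k 1)"
      unfolding V_eq_ternary using row by (intro UN_least refinements_subset_ternary vals) auto
    fix x y assume "x \<in> (\<Union>w\<in>W. ?R w)" "y \<in> (\<Union>w\<in>W. ?R w)"
    then show "dot n x y \<noteq> t"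
      using same diff by (metis UN_E less_irrefl)
  qed
  then have "card (\<Union>w\<in>W. ?R w) \<le> m_max n (k (-1)) (k 0) (k 1) t"
    unfolding m_max_def using fin_M by (intro Max_ge) auto
  moreover have "card (\<Union>w\<in>W. ?R w) = (\<Sum>w\<in>W. card (?R w))"
  proof (rule card_UN_disjoint)
    show "finite W"
      using W(1) finite_V finite_subset by blast
    show "\<forall>w\<in>W. finite (?R w)"
      by (auto intro: finite_subset[of _ "{..<n} \<rightarrow>\<^sub>E {-1, 0, 1}"] simp: refinements_def finite_PiE)
    \<comment> \<open>A common refinement \<open>x\<close> would give \<open>dot n x x > t\<close>
      by \<open>same\<close> and \<open>dot n x x < t\<close> by \<open>diff\<close>.\<close>
    show "\<forall>w\<in>W. \<forall>v\<in>W. w \<noteq> v \<longrightarrow> ?R w \<inter> ?R v = {}"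
      using same diff by (metis disjoint_iff order_less_asym)
  qed
  moreover have "(\<Sum>w\<in>W. card (?R w)) = card W * ?p"
  proof -
    have "card (?R w) = ?p" if "w \<in> W" for w
      using card_refinements[OF _ vals[OF that], of mm] count[OF that] col by simp
    then show ?thesis
      by simp
  qed
  ultimately show ?thesis
    by (simp only: h)
qed

end
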